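(* For every positive integer $N$ and every real $x\in(-\infty,-1)$, $$\sum_{n=0}^{2N-1}a_{n}T_{n}(x)\;\leq\; e^{x}\;\leq\;\sum_{n=0}^{2N}a_{n}T_{n}(x),$$ where $T_n$ is the $n$-th Chebyshev polynomial of the first kind and $(a_n)_{n\ge 0}$ are the coefficients of the Chebyshev series expansion of the function $e^{x}$ in $L^{2}\left([-1,1],\frac{1}{\sqrt{1-x^{2}}}dx\right)$.
   Context: $T_n$ denotes the Chebyshev polynomial of the first kind, i.e. the real polynomial of degree $n$ with $T_n(\cos\theta)=\cos(n\theta)$, so $T_0=1$. The Chebyshev coefficients of $e^x$ are the coefficients of its orthogonal expansion in the polynomials $T_n$ in $L^{2}\left([-1,1],\frac{1}{\sqrt{1-x^{2}}}dx\right)$: $$a_0=\frac1\pi\int_{-1}^1\frac{e^x}{\sqrt{1-x^2}}\,dx,\qquad a_n=\frac2\pi\int_{-1}^1\frac{e^xT_n(x)}{\sqrt{1-x^2}}\,dx\quad(n\ge1).$$ Equivalently, $a_0=I_0(1)$ and $a_n=2I_n(1)$ for $n\geq 1$, where $I_n(x)=\sum_{m=0}^{\infty}\frac{1}{m!\,\Gamma(m+n+1)}\left(\frac{x}{2}\right)^{2m+n}$ is the modified Bessel function of the first kind. *)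

theory Defs
  imports "HOL-Analysis.Analysis" "HOL-Computational_Algebra.Polynomial"
begin

definition Chebyshev_T :: "nat \<Rightarrow> real poly" where
  "Chebyshev_T n =
     (THE p. degree p = n \<and> (\<forall>\<theta>. poly p (cos \<theta>) = cos (real n * \<theta>)))"

(* The integrands below are undefined at -1 and 1, where HOL's x / 0 = 0 applies; these two
   points are a null set. *)
definition chebyshev_coeff :: "(real \<Rightarrow> real) \<Rightarrow> nat \<Rightarrow> real" where
  "chebyshev_coeff f n =
     (if n = 0 then 1 / pi * (LBINT x:{-1..1}. f x / sqrt (1 - x\<^sup>2))
      else 2 / pi * (LBINT x:{-1..1}. f x * poly (Chebyshev_T n) x / sqrt (1 - x\<^sup>2)))"

lemma Chebyshev_T_unique:
  fixes p q :: "real poly"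
  assumes "\<And>\<theta>. poly p (cos \<theta>) = poly q (cos \<theta>)"
  shows "p = q"
proof (rule ccontr)
  assume "p \<noteq> q"
  then have fin: "finite {x. poly (p - q) x = 0}"
    by (intro poly_roots_finite) simp
  have "x \<in> {x. poly (p - q) x = 0}" if "x \<in> {-1..1}" for x
    using assms[of "arccos x"] that by (simp add: cos_arccos)
  then have "finite {-1..1::real}"
    using fin by (meson finite_subset subsetI)
  then show False by (simp add: infinite_Icc)
qed

lemma Chebyshev_T_ex:
  "\<exists>p q :: real poly. degree p = n \<and> degree q = Suc n
     \<and> (\<forall>\<theta>. poly p (cos \<theta>) = cos (real n * \<theta>))
     \<and> (\<forall>\<theta>. poly q (cos \<theta>) = cos (real (Suc n) * \<theta>))"
proof (induction n)
  case 0
  show ?case by (rule exI[of _ 1], rule exI[of _ "[:0, 1:]"]) simp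
next
  case (Suc n)
  then obtain p q :: "real poly" where d: "degree p = n" "degree q = Suc n"
    and p: "\<And>\<theta>. poly p (cos \<theta>) = cos (real n * \<theta>)"
    and q: "\<And>\<theta>. poly q (cos \<theta>) = cos (real (Suc n) * \<theta>)"
    by blast
  define r where "r = pCons 0 (smult 2 q) + (- p)"
  have "q \<noteq> 0" using d by auto
  then have dq: "degree (pCons 0 (smult 2 q)) = Suc (Suc n)"
    using d by simp
  have "degree r = Suc (Suc n)"
    unfolding r_def using dq d by (subst degree_add_eq_left) auto
  moreover have "poly r (cos \<theta>) = cos (real (Suc (Suc n)) * \<theta>)" for \<theta>
  proof -
    have a: "real (Suc (Suc n)) * \<theta> = real (Suc n) * \<theta> + \<theta>"
      and b: "real n * \<theta> = real (Suc n) * \<theta> - \<theta>"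
      by (simp_all add: algebra_simps)
    show ?thesis
      unfolding a r_def by (simp only: poly_add poly_minus poly_pCons poly_smult p q)
        (simp only: b cos_add cos_diff, simp)
  qed
  ultimately show ?case using d q by blast
qed

lemma Chebyshev_T_spec:
  "degree (Chebyshev_T n) = n \<and> (\<forall>\<theta>. poly (Chebyshev_T n) (cos \<theta>) = cos (real n * \<theta>))"
proof -
  obtain p :: "real poly" where
    "degree p = n \<and> (\<forall>\<theta>. poly p (cos \<theta>) = cos (real n * \<theta>))"
    using Chebyshev_T_ex[of n] by blast
  then show ?thesis
    unfolding Chebyshev_T_def
    by (rule theI) (use Chebyshev_T_unique \<open>_ \<and> _\<close> in metis)
qed

end

theory Submission
  imports Defs
begin

text \<open>
  Fix \<open>M\<close> and let \<open>D\<close> be the difference between \<open>exp\<close> and its Chebyshev partial sum of degree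
  \<open>M\<close>.  For \<open>x < -1\<close> the terms of the Chebyshev series alternate in sign, but their absolute
  values need not decrease, so the Leibniz criterion for alternating series does not apply.  The
  proof instead recognises the partial sum as a Lagrange interpolant of \<open>exp\<close>.

  The difference \<open>D\<close> is orthogonal, with respect to the Chebyshev weight, to every polynomial of
  degree at most \<open>M\<close>.  If \<open>D\<close> had at most \<open>M\<close> zeros in \<open>[-1, 1]\<close>, the product of the factors
  \<open>x - z\<close> over those zeros \<open>z\<close> at which \<open>D\<close> changes sign would be such a polynomial, and \<open>D\<close> times
  it would be a continuous function of constant sign with integral zero, hence identically zero
  (\<open>orthogonal_imp_many_zeros\<close>).  So the partial sum interpolates \<open>exp\<close> at \<open>M + 1\<close> distinct nodes
  in \<open>[-1, 1]\<close>.

  All derivatives of \<open>exp\<close> are positive.  By repeated use of Rolle's theorem the interpolation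
  error is therefore a positive multiple of the product of the factors \<open>x - z\<close> over the nodes
  \<open>z\<close> (\<open>exp_interpolation_error_sign\<close>).  For \<open>x < -1\<close> all \<open>M + 1\<close> factors are negative, so the
  error has the sign of \<open>(-1)^(M + 1)\<close>.
\<close>

section \<open>The error of polynomial interpolation of the exponential\<close>

text \<open>
  The bound by \<open>Max S\<close> serves the induction: the zero of \<open>f'\<close> found between the two largest
  elements of \<open>S\<close> is then distinct from those found earlier.
\<close>

lemma Rolle_finite_zeros:
  fixes f f' :: "real \<Rightarrow> real"
  assumes deriv: "\<And>x. (f has_real_derivative f' x) (at x)"
    and "finite S" "card S = Suc k" and "\<And>x. x \<in> S \<Longrightarrow> f x = 0"
  shows "\<exists>S'. finite S' \<and> card S' = k \<and> (\<forall>x\<in>S'. f' x = 0 \<and> x < Max S)"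
  using assms(2-4)
proof (induction k arbitrary: S)
  case 0
  then show ?case by (intro exI[of _ "{}"]) auto
next
  case (Suc k)
  define b where "b = Max S"
  define T where "T = S - {b}"
  have "S \<noteq> {}" using Suc.prems by auto
  then have b: "b \<in> S" using Suc.prems by (simp add: b_def)
  have T: "finite T" "card T = Suc k"
    using Suc.prems b by (auto simp: T_def)
  then have "T \<noteq> {}" by auto
  define a where "a = Max T"
  have a: "a \<in> T" using T \<open>T \<noteq> {}\<close> by (simp add: a_def)
  have "a \<le> b" using a Suc.prems(1) by (simp add: b_def T_def)
  then have ab: "a < b" using a by (auto simp: T_def)
  have "\<And>x. x \<in> T \<Longrightarrow> f x = 0" using Suc.prems(3) by (simp add: T_def)
  then obtain T' where T': "finite T'" "card T' = k" "\<forall>x\<in>T'. f' x = 0 \<and> x < a"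
    using Suc.IH[OF T] by (auto simp: a_def)
  have cont: "continuous_on {a..b} f"
    using deriv by (intro continuous_at_imp_continuous_on) (auto intro: DERIV_isCont)
  have "f a = f b" using Suc.prems(3) a b by (simp add: T_def)
  then obtain z where z: "a < z" "z < b" "(f has_real_derivative 0) (at z)"
    using Rolle[OF ab _ cont] deriv real_differentiable_def by blast
  then have "f' z = 0" using DERIV_unique deriv by blast
  have "z \<notin> T'" using T' z by force
  then show ?case
    using T' z ab \<open>f' z = 0\<close>
    by (intro exI[of _ "insert z T'"]) (auto simp: b_def[symmetric])
qed

text \<open>
  Differentiation fixes \<open>exp\<close> and multiplies the coefficient of \<open>x ^ Suc m\<close> by \<open>Suc m\<close>, so Rolle's
  theorem reduces the claim to one with one zero fewer; in the end a constant equals a value of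
  \<open>exp\<close>.  Taking \<open>m\<close> above the degree of \<open>p\<close> turns this into a bound on the number of zeros.
\<close>

lemma exp_eq_poly_imp_coeff_pos:
  fixes p :: "real poly"
  assumes "degree p \<le> m" "finite S" "card S = Suc m" "\<And>x. x \<in> S \<Longrightarrow> exp x = poly p x"
  shows "coeff p m > 0"
  using assms
proof (induction m arbitrary: p S)
  case 0
  then obtain c where "p = [:c:]" by (meson degree_eq_zeroE le_zero_eq)
  moreover obtain x where "x \<in> S" using "0.prems" by fastforce
  ultimately show ?case using "0.prems"(4)[of x] exp_gt_zero[of x] by simp
next
  case (Suc m)
  have "\<exists>S'. finite S' \<and> card S' = Suc m \<and>
      (\<forall>x\<in>S'. exp x - poly (pderiv p) x = 0 \<and> x < Max S)"
    by (rule Rolle_finite_zeros[where f = "\<lambda>x. exp x - poly p x"])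
      (use Suc.prems in \<open>auto intro!: derivative_eq_intros\<close>)
  then obtain S' where "finite S'" "card S' = Suc m" "\<And>x. x \<in> S' \<Longrightarrow> exp x = poly (pderiv p) x"
    by auto
  moreover have "degree (pderiv p) \<le> m"
    using Suc.prems(1) by (simp add: degree_pderiv)
  ultimately have "coeff (pderiv p) m > 0" by (intro Suc.IH)
  then show ?case by (simp add: coeff_pderiv zero_less_mult_iff)
qed

lemma finite_exp_eq_poly: "finite {x::real. exp x = poly p x}"
proof (rule ccontr)
  assume "infinite {x::real. exp x = poly p x}"
  then obtain S where "finite S" "card S = Suc (Suc (degree p))" "S \<subseteq> {x. exp x = poly p x}"
    by (meson infinite_arbitrarily_large)
  then have "coeff p (Suc (degree p)) > 0"
    by (intro exp_eq_poly_imp_coeff_pos) auto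
  then show False by (simp add: coeff_eq_0)
qed

text \<open>
  Adding to \<open>p\<close> the multiple \<open>c\<close> of the node polynomial that corrects its value at \<open>x\<close> gives an
  interpolant at \<open>m + 1\<close> points with leading coefficient \<open>c\<close>, so \<open>c\<close> is positive.
\<close>

lemma exp_interpolation_error_sign:
  fixes p :: "real poly"
  assumes "degree p < card S" "finite S" "\<And>z. z \<in> S \<Longrightarrow> exp z = poly p z" "\<And>z. z \<in> S \<Longrightarrow> x < z"
  shows "0 < (-1) ^ card S * (exp x - poly p x)"
proof -
  define w :: "real poly" where "w = (\<Prod>z\<in>S. [:- z, 1:])"
  have deg_w: "degree w = card S"
    by (simp add: w_def degree_prod_eq_sum_degree)
  have "lead_coeff w = 1"
    by (simp add: w_def lead_coeff_prod)
  then have coeff_w: "coeff w (card S) = 1" by (simp add: deg_w)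
  have poly_w: "poly w y = (\<Prod>z\<in>S. y - z)" for y
    by (simp add: w_def poly_prod)
  have "poly w x = (\<Prod>z\<in>S. (-1) * (z - x))"
    by (simp add: poly_w)
  also have "\<dots> = (-1) ^ card S * (\<Prod>z\<in>S. z - x)"
    by (subst prod.distrib) simp
  finally have w_x: "poly w x = (-1) ^ card S * (\<Prod>z\<in>S. z - x)" .
  have pos: "(\<Prod>z\<in>S. z - x) > 0"
    using assms(4) by (intro prod_pos) simp
  define c where "c = (exp x - poly p x) / poly w x"
  have "x \<notin> S" using assms(4) by force
  have "coeff (p + smult c w) (card S) > 0"
  proof (rule exp_eq_poly_imp_coeff_pos)
    show "degree (p + smult c w) \<le> card S"
      using assms(1) deg_w by (intro degree_add_le) (auto intro: order.trans[OF degree_smult_le])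
    show "finite (insert x S)" "card (insert x S) = Suc (card S)"
      using assms(2) \<open>x \<notin> S\<close> by auto
    show "exp y = poly (p + smult c w) y" if y: "y \<in> insert x S" for y
    proof (cases "y = x")
      case True
      then show ?thesis using pos w_x by (simp add: c_def)
    next
      case False
      then have "y \<in> S" using y by simp
      then have "poly w y = 0" using assms(2) by (auto simp: poly_w)
      then show ?thesis using assms(3) \<open>y \<in> S\<close> by simp
    qed
  qed
  then have "c > 0" using assms(1) by (simp add: coeff_w coeff_eq_0)
  have "exp x - poly p x = c * poly w x" using pos w_x by (simp add: c_def)
  then have "(-1) ^ card S * (exp x - poly p x) = c * ((-1) ^ card S * (-1) ^ card S) * (\<Prod>z\<in>S. z - x)"
    by (simp add: w_x)
  also have "\<dots> = c * (\<Prod>z\<in>S. z - x)"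
    by (simp flip: power_mult_distrib)
  finally show ?thesis using \<open>c > 0\<close> pos by simp
qed

section \<open>Sign changes of functions orthogonal to polynomials\<close>

lemma nonzero_continuous_constant_sign:
  fixes f :: "real \<Rightarrow> real"
  assumes "continuous_on {a<..<b} f" "\<And>x. x \<in> {a<..<b} \<Longrightarrow> f x \<noteq> 0"
  shows "\<exists>s\<in>{1, -1}. \<forall>x\<in>{a<..<b}. 0 < s * f x"
proof (rule ccontr)
  assume neg: "\<not> ?thesis"
  obtain x where x: "x \<in> {a<..<b}" "f x \<le> 0"
    using neg not_less[of 0] by (metis insertI1 mult_1)
  obtain y where "y \<in> {a<..<b}" "\<not> 0 < -1 * f y"
    using neg by blast
  then have y: "y \<in> {a<..<b}" "f y \<ge> 0" by auto
  have "connected (f ` {a<..<b})"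
    using assms(1) by (intro connected_continuous_image) auto
  then have "0 \<in> f ` {a<..<b}"
    using connectedD_interval[of _ "f x" "f y" 0] x y by blast
  then show False using assms(2) by (metis imageE)
qed

text \<open>
  Here \<open>A\<close> collects the zeros at which \<open>f\<close> changes sign.  The induction passes the zeros from left
  to right: the factors already chosen are positive to the right of the last zero, so whether that
  zero enters \<open>A\<close> depends only on the signs on its two sides.
\<close>

lemma constant_sign_after_multiplication:
  fixes f :: "real \<Rightarrow> real"
  assumes "finite Z" "continuous_on {a<..<b} f" "\<And>x. x \<in> {a<..<b} \<Longrightarrow> f x = 0 \<longleftrightarrow> x \<in> Z"
  shows "\<exists>A\<subseteq>Z. \<exists>s\<in>{1, -1}. \<forall>x\<in>{a<..<b}. 0 \<le> s * f x * (\<Prod>z\<in>A. x - z)"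
  using assms
proof (induction arbitrary: b rule: finite_linorder_max_induct)
  case empty
  then obtain s where "s \<in> {1, -1}" "\<forall>x\<in>{a<..<b}. 0 < s * f x"
    using nonzero_continuous_constant_sign[of a b f] by blast
  then show ?case by (intro exI[of _ "{}"] conjI bexI[of _ s]) (auto simp: less_imp_le)
next
  case (insert z Z)
  show ?case
  proof (cases "z \<in> {a<..<b}")
    case False
    then have "\<And>x. x \<in> {a<..<b} \<Longrightarrow> f x = 0 \<longleftrightarrow> x \<in> Z" using insert.prems by auto
    from insert.IH[OF insert.prems(1) this] show ?thesis by blast
  next
    case True
    have "continuous_on {a<..<z} f"
      using insert.prems(1) True by (auto intro: continuous_on_subset)
    moreover have "\<And>x. x \<in> {a<..<z} \<Longrightarrow> f x = 0 \<longleftrightarrow> x \<in> Z" using insert.prems(2) True by auto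
    ultimately obtain A s where A: "A \<subseteq> Z" and s: "s \<in> {1, -1}"
      and left: "\<And>x. x \<in> {a<..<z} \<Longrightarrow> 0 \<le> s * f x * (\<Prod>z\<in>A. x - z)"
      using insert.IH[of z] by blast
    have "continuous_on {z<..<b} f"
      using insert.prems(1) True by (auto intro: continuous_on_subset)
    moreover have "\<And>x. x \<in> {z<..<b} \<Longrightarrow> f x \<noteq> 0"
      using insert.prems(2) insert.hyps True by force
    ultimately obtain t where t: "t \<in> {1, -1}" and right: "\<And>x. x \<in> {z<..<b} \<Longrightarrow> 0 < t * f x"
      using nonzero_continuous_constant_sign[of z b f] by blast
    have fin: "finite A" "z \<notin> A"
      using A insert.hyps finite_subset by auto
    have pos: "(\<Prod>z\<in>A. x - z) > 0" if "x > z" for x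
      using that A insert.hyps by (intro prod_pos) force
    have fz: "f z = 0" using insert.prems(2) True by simp
    show ?thesis
    proof (cases "s = t")
      case True
      have "0 \<le> s * f x * (\<Prod>z\<in>A. x - z)" if "x \<in> {a<..<b}" for x
        using left[of x] right[of x] pos[of x] fz that True
        by (cases x z rule: linorder_cases) auto
      then show ?thesis using A s by blast
    next
      case False
      then have st: "t = - s" using s t by auto
      have "0 \<le> t * f x * (\<Prod>z\<in>insert z A. x - z)" if x: "x \<in> {a<..<b}" for x
      proof (cases x z rule: linorder_cases)
        case less
        have eq: "t * f x * (\<Prod>z\<in>insert z A. x - z) = (s * f x * (\<Prod>z\<in>A. x - z)) * (z - x)"
          using fin by (simp add: st algebra_simps)
        show ?thesis
          unfolding eq by (rule mult_nonneg_nonneg[OF left]) (use less x in auto)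
      next
        case greater
        have eq: "t * f x * (\<Prod>z\<in>insert z A. x - z) = (t * f x) * (\<Prod>z\<in>A. x - z) * (x - z)"
          using fin by (simp add: algebra_simps)
        show ?thesis
          unfolding eq
          by (intro mult_nonneg_nonneg less_imp_le[OF right] less_imp_le[OF pos]) (use greater x in auto)
      qed (simp add: fz)
      then show ?thesis using A t by blast
    qed
  qed
qed

lemma orthogonal_imp_many_zeros:
  fixes f :: "real \<Rightarrow> real"
  assumes cont: "continuous_on {-1..1} f" and fin: "finite {x\<in>{-1..1}. f x = 0}"
    and orth: "\<And>q :: real poly. degree q \<le> M \<Longrightarrow>
      integral {0..pi} (\<lambda>t. f (cos t) * poly q (cos t)) = 0"
  shows "M < card {x\<in>{-1..1}. f x = 0}"
proof (rule ccontr)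
  define Z where "Z = {x\<in>{-1..1}. f x = 0}"
  assume "\<not> ?thesis"
  then have card: "card Z \<le> M" by (simp add: Z_def)
  have finZ: "finite Z" using fin by (simp add: Z_def)
  have cont': "continuous_on {-1<..<1} f" by (rule continuous_on_subset[OF cont]) auto
  have zeros: "f x = 0 \<longleftrightarrow> x \<in> Z" if "x \<in> {-1<..<1}" for x
    using that by (auto simp: Z_def)
  from constant_sign_after_multiplication[OF finZ cont' zeros]
  obtain A s where A: "A \<subseteq> Z" and s: "s \<in> {1, -1}"
    and sign: "\<And>x. x \<in> {-1<..<1} \<Longrightarrow> 0 \<le> s * f x * (\<Prod>z\<in>A. x - z)"
    by blast
  define q :: "real poly" where "q = smult s (\<Prod>z\<in>A. [:- z, 1:])"
  have poly_q: "poly q x = s * (\<Prod>z\<in>A. x - z)" for x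
    by (simp add: q_def poly_prod)
  have finA: "finite A" using A finZ finite_subset by blast
  have "degree q \<le> card A"
    using degree_smult_le[of s] by (simp add: q_def degree_prod_eq_sum_degree)
  also have "\<dots> \<le> M" using card card_mono[OF finZ A] by linarith
  finally have int0: "integral {0..pi} (\<lambda>t. f (cos t) * poly q (cos t)) = 0" by (rule orth)
  have closure: "closure {-1<..<1} = {-1..1::real}" by simp
  have nonneg: "0 \<le> f x * poly q x" if "x \<in> {-1..1}" for x
  proof (rule continuous_ge_on_closure[where f = "\<lambda>x. f x * poly q x"])
    show "continuous_on (closure {-1<..<1}) (\<lambda>x. f x * poly q x)"
      unfolding closure by (intro continuous_intros cont)
    show "0 \<le> f y * poly q y" if "y \<in> {-1<..<1}" for y
      using sign[OF that] by (simp add: poly_q mult_ac)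
  qed (use that closure in auto)
  have "continuous_on {0..pi} (\<lambda>t. f (cos t) * poly q (cos t))"
    by (intro continuous_intros continuous_on_compose2[OF cont]) auto
  then have zero: "\<forall>t\<in>{0..pi}. f (cos t) * poly q (cos t) = 0"
    using int0 by (subst (asm) integral_eq_0_iff) (auto intro: nonneg)
  have "{-1..1} \<subseteq> Z"
  proof
    fix x :: real
    assume x: "x \<in> {-1..1}"
    then have "f x * poly q x = 0"
      using zero[rule_format, of "arccos x"] by (simp add: arccos_lbound arccos_ubound)
    then show "x \<in> Z"
      using x A s finA by (auto simp: Z_def poly_q)
  qed
  then have "finite {-1..1::real}" using finZ finite_subset by blast
  then show False by (simp add: infinite_Icc)
qed

section \<open>Orthogonality of the Chebyshev remainder\<close>

lemma poly_Chebyshev_T_cos: "poly (Chebyshev_T n) (cos t) = cos (real n * t)"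
  and degree_Chebyshev_T: "degree (Chebyshev_T n) = n"
  using Chebyshev_T_spec by auto

text \<open>
  This is the substitution \<open>x = cos t\<close>.  At both endpoints the integrand on the left is \<open>0\<close>, as
  a quotient by \<open>0\<close>, so it may be replaced by its restriction to the open interval, where it is
  continuous and therefore Borel measurable.
\<close>

lemma integral_chebyshev_weight:
  fixes h :: "real \<Rightarrow> real"
  assumes "continuous_on {-1..1} h"
  shows "(LBINT x:{-1..1}. h x / sqrt (1 - x\<^sup>2)) = integral {0..pi} (\<lambda>t. h (cos t))"
proof -
  define f where "f = (\<lambda>x. h x / sqrt (1 - x\<^sup>2))"
  have img: "cos ` {0<..<pi} = {-1<..<1}"
  proof (intro equalityI subsetI)
    fix x assume "x \<in> cos ` {0<..<pi}"
    then obtain t where t: "0 < t" "t < pi" "x = cos t" by auto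
    then show "x \<in> {-1<..<1}"
      using cos_monotone_0_pi[of 0 t] cos_monotone_0_pi[of t pi] by simp
  next
    fix x :: real assume x: "x \<in> {-1<..<1}"
    then show "x \<in> cos ` {0<..<pi}"
      by (intro image_eqI[of _ _ "arccos x"]) (auto simp: arccos_lt_bounded)
  qed
  have inj: "inj_on cos {0<..<pi}"
    by (rule inj_onI) (auto intro: cos_inj_pi)
  have eq: "\<bar>- sin t\<bar> * f (cos t) = h (cos t)" if "t \<in> {0<..<pi}" for t
  proof -
    have "sin t > 0" using that by (simp add: sin_gt_zero)
    moreover have "sqrt (1 - (cos t)\<^sup>2) = sin t"
      using \<open>sin t > 0\<close> by (simp add: sin_squared_eq[symmetric])
    ultimately show ?thesis by (simp add: f_def)
  qed
  have "continuous_on {0..pi} (\<lambda>t. h (cos t))"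
    by (intro continuous_on_compose2[OF assms] continuous_intros) auto
  then have "(\<lambda>t. h (cos t)) absolutely_integrable_on {0..pi}"
    by (rule absolutely_integrable_continuous_real)
  then have "(\<lambda>t. h (cos t)) absolutely_integrable_on {0<..<pi}"
    by (rule set_integrable_subset) auto
  moreover have "set_integrable lebesgue {0<..<pi} (\<lambda>t. \<bar>- sin t\<bar> * f (cos t)) =
      set_integrable lebesgue {0<..<pi} (\<lambda>t. h (cos t))"
    by (intro set_integrable_cong refl) (rule eq)
  moreover have "integral {0<..<pi} (\<lambda>t. \<bar>- sin t\<bar> * f (cos t)) =
      integral {0<..<pi} (\<lambda>t. h (cos t))"
    by (intro integral_cong) (rule eq)
  moreover have "integral {0<..<pi} (\<lambda>t. h (cos t)) = integral {0..pi} (\<lambda>t. h (cos t))"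
    by (rule integral_open_interval_real[symmetric])
  moreover have "(\<lambda>t. \<bar>- sin t\<bar> * f (cos t)) absolutely_integrable_on {0<..<pi} \<and>
      integral {0<..<pi} (\<lambda>t. \<bar>- sin t\<bar> * f (cos t)) = integral {0..pi} (\<lambda>t. h (cos t)) \<longleftrightarrow>
      f absolutely_integrable_on (cos ` {0<..<pi}) \<and>
      integral (cos ` {0<..<pi}) f = integral {0..pi} (\<lambda>t. h (cos t))"
    by (rule has_absolute_integral_change_of_variables_1')
      (auto intro!: derivative_eq_intros inj)
  ultimately have f: "f absolutely_integrable_on {-1<..<1}"
    "integral {-1<..<1} f = integral {0..pi} (\<lambda>t. h (cos t))"
    unfolding img by simp_all
  have "1 - x\<^sup>2 \<noteq> 0" if "x \<in> {-1<..<1}" for x :: real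
    using that by (auto simp: power2_eq_1_iff)
  then have "continuous_on {-1<..<1} f"
    unfolding f_def by (intro continuous_intros continuous_on_subset[OF assms]) auto
  then have "(\<lambda>x. indicator {-1<..<1} x *\<^sub>R f x) \<in> borel_measurable borel"
    by (intro borel_measurable_continuous_on_indicator) auto
  then have "set_integrable lborel {-1<..<1} f"
    using f(1) unfolding set_integrable_def by (subst (asm) integrable_completion) auto
  then have "(LBINT x:{-1<..<1}. f x) = integral {0..pi} (\<lambda>t. h (cos t))"
    using set_borel_integral_eq_integral(2) f(2) by metis
  moreover have "(LBINT x:{-1..1}. f x) = (LBINT x:{-1<..<1}. f x)"
    unfolding set_lebesgue_integral_def
    by (rule Bochner_Integration.integral_cong)
      (auto simp: f_def indicator_def less_le)
  ultimately show ?thesis by (simp add: f_def)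
qed

lemma chebyshev_coeff_eq_integral_cos:
  assumes "continuous_on {-1..1} f"
  shows "chebyshev_coeff f n =
    (if n = 0 then 1 / pi else 2 / pi) * integral {0..pi} (\<lambda>t. f (cos t) * cos (real n * t))"
proof (cases "n = 0")
  case True
  then show ?thesis
    using integral_chebyshev_weight[OF assms] by (simp add: chebyshev_coeff_def)
next
  case False
  have "continuous_on {-1..1} (\<lambda>x. f x * poly (Chebyshev_T n) x)"
    by (intro continuous_intros assms)
  from integral_chebyshev_weight[OF this] show ?thesis
    using False by (simp add: chebyshev_coeff_def poly_Chebyshev_T_cos)
qed

lemma has_integral_cos_int_mult:
  "((\<lambda>t. cos (real_of_int k * t)) has_integral (if k = 0 then pi else 0)) {0..pi}"
proof (cases "k = 0")
  case True
  then show ?thesis using has_integral_const_real[of "1::real" 0 pi] by simp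
next
  case False
  have "((\<lambda>t. cos (real_of_int k * t)) has_integral
      (sin (real_of_int k * pi) / real_of_int k - sin (real_of_int k * 0) / real_of_int k)) {0..pi}"
    using False
    by (intro fundamental_theorem_of_calculus)
      (auto intro!: derivative_eq_intros simp flip: has_real_derivative_iff_has_vector_derivative)
  moreover have "sin (real_of_int k * pi) = 0"
    by (simp add: sin_zero_iff_int2)
  ultimately show ?thesis using False by simp
qed

lemma has_integral_cos_mult_cos:
  "((\<lambda>t. cos (real m * t) * cos (real n * t)) has_integral
     (if m \<noteq> n then 0 else if n = 0 then pi else pi / 2)) {0..pi}"
proof -
  have "((\<lambda>t. (cos (real_of_int (int m - int n) * t) + cos (real_of_int (int m + int n) * t)) / 2)
      has_integral ((if int m - int n = 0 then pi else 0) + (if int m + int n = 0 then pi else 0)) / 2)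
      {0..pi}"
    by (intro has_integral_divide has_integral_add has_integral_cos_int_mult)
  moreover have "(cos (real_of_int (int m - int n) * t) + cos (real_of_int (int m + int n) * t)) / 2
      = cos (real m * t) * cos (real n * t)" for t
    by (simp add: cos_times_cos algebra_simps)
  moreover have "int m - int n = 0 \<longleftrightarrow> m = n" "int m + int n = 0 \<longleftrightarrow> m = 0 \<and> n = 0"
    by auto
  ultimately show ?thesis by (simp only:) (auto simp: if_distrib cong: if_cong)
qed

definition chebyshev_partial_sum :: "(real \<Rightarrow> real) \<Rightarrow> nat \<Rightarrow> real poly" where
  "chebyshev_partial_sum f M = (\<Sum>n\<le>M. smult (chebyshev_coeff f n) (Chebyshev_T n))"

lemma degree_chebyshev_partial_sum: "degree (chebyshev_partial_sum f M) \<le> M"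
  unfolding chebyshev_partial_sum_def
  by (intro degree_sum_le) (auto intro: order.trans[OF degree_smult_le] simp: degree_Chebyshev_T)

lemma chebyshev_remainder_orthogonal_cos:
  assumes "continuous_on {-1..1} f" and "k \<le> M"
  shows "integral {0..pi}
    (\<lambda>t. (f (cos t) - poly (chebyshev_partial_sum f M) (cos t)) * cos (real k * t)) = 0"
proof -
  let ?c = "chebyshev_coeff f"
  let ?I = "\<lambda>n. if n \<noteq> k then 0 else if k = 0 then pi else pi / 2"
  have "((\<lambda>t. \<Sum>n\<le>M. ?c n * (cos (real n * t) * cos (real k * t)))
      has_integral (\<Sum>n\<le>M. ?c n * ?I n)) {0..pi}"
    by (intro has_integral_sum has_integral_mult_right has_integral_cos_mult_cos) auto
  moreover have "(\<Sum>n\<le>M. ?c n * ?I n) = integral {0..pi} (\<lambda>t. f (cos t) * cos (real k * t))"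
  proof -
    have "(\<Sum>n\<le>M. ?c n * ?I n) = (\<Sum>n\<le>M. if n = k then ?c k * ?I k else 0)"
      by (intro sum.cong) auto
    also have "\<dots> = ?c k * ?I k" using assms(2) by simp
    finally show ?thesis by (simp add: chebyshev_coeff_eq_integral_cos[OF assms(1)])
  qed
  moreover have "((\<lambda>t. f (cos t) * cos (real k * t)) has_integral
      integral {0..pi} (\<lambda>t. f (cos t) * cos (real k * t))) {0..pi}"
    by (intro integrable_integral integrable_continuous_real continuous_intros
        continuous_on_compose2[OF assms(1)]) auto
  ultimately have "((\<lambda>t. f (cos t) * cos (real k * t) -
      (\<Sum>n\<le>M. ?c n * (cos (real n * t) * cos (real k * t)))) has_integral
      integral {0..pi} (\<lambda>t. f (cos t) * cos (real k * t)) -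
      integral {0..pi} (\<lambda>t. f (cos t) * cos (real k * t))) {0..pi}"
    by (simp only: has_integral_diff)
  then show ?thesis
    by (intro integral_unique)
      (simp add: chebyshev_partial_sum_def poly_sum poly_Chebyshev_T_cos left_diff_distrib
        sum_distrib_right mult.assoc)
qed

text \<open>
  Since \<open>Chebyshev_T n\<close> has exact degree \<open>n\<close>, the leading term of \<open>q\<close> can be removed by
  subtracting a multiple of a Chebyshev polynomial, on which the integral is known to vanish.
\<close>

lemma chebyshev_remainder_orthogonal:
  fixes q :: "real poly"
  assumes "continuous_on {-1..1} f" and "degree q \<le> M"
  shows "integral {0..pi}
    (\<lambda>t. (f (cos t) - poly (chebyshev_partial_sum f M) (cos t)) * poly q (cos t)) = 0"
  using assms(2)
proof (induction "degree q" arbitrary: q rule: less_induct)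
  case less
  define D where "D = (\<lambda>t. f (cos t) - poly (chebyshev_partial_sum f M) (cos t))"
  define k where "k = degree q"
  define c where "c = lead_coeff q / lead_coeff (Chebyshev_T k)"
  define r where "r = q - smult c (Chebyshev_T k)"
  have contD: "continuous_on {0..pi} D"
    unfolding D_def by (intro continuous_intros continuous_on_compose2[OF assms(1)]) auto
  have zero: "integral {0..pi} (\<lambda>t. D t * cos (real k * t)) = 0"
    using chebyshev_remainder_orthogonal_cos[OF assms(1), of k M] less.prems
    by (simp add: D_def k_def)
  have "integral {0..pi} (\<lambda>t. D t * poly r (cos t)) = 0"
  proof (cases "r = 0")
    case False
    have "Chebyshev_T k \<noteq> 0"
    proof
      assume "Chebyshev_T k = 0"
      then show False using poly_Chebyshev_T_cos[of k 0] by simp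
    qed
    then have "lead_coeff (Chebyshev_T k) \<noteq> 0" by simp
    then have "coeff r k = 0"
      by (simp add: r_def c_def k_def degree_Chebyshev_T)
    moreover have "degree r \<le> k"
      unfolding r_def k_def
      by (intro degree_diff_le) (auto intro: order.trans[OF degree_smult_le] simp: degree_Chebyshev_T)
    ultimately have "degree r < k"
      using False by (metis le_neq_implies_less leading_coeff_0_iff)
    then show ?thesis using less.hyps[of r] less.prems by (simp add: D_def k_def)
  qed simp
  moreover have "(\<lambda>t. D t * poly q (cos t)) =
      (\<lambda>t. D t * poly r (cos t) + c * (D t * cos (real k * t)))"
    by (simp add: r_def poly_Chebyshev_T_cos algebra_simps)
  moreover have "(\<lambda>t. D t * poly r (cos t)) integrable_on {0..pi}"
    "(\<lambda>t. c * (D t * cos (real k * t))) integrable_on {0..pi}"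
    by (intro integrable_continuous_real continuous_intros contD)+
  ultimately have "integral {0..pi} (\<lambda>t. D t * poly q (cos t)) = 0"
    using zero by (simp add: Henstock_Kurzweil_Integration.integral_add)
  then show ?case by (simp add: D_def)
qed

section \<open>The sign of the remainder to the left of the interval\<close>

lemma exp_chebyshev_remainder_sign:
  assumes "x < -1"
  shows "0 < (-1) ^ Suc M * (exp x - poly (chebyshev_partial_sum exp M) x)"
proof -
  define p where "p = chebyshev_partial_sum exp M"
  define Z where "Z = {x\<in>{-1..1}. exp x - poly p x = 0}"
  have cont: "continuous_on {-1..1} (exp :: real \<Rightarrow> real)" by (intro continuous_intros)
  have "Z \<subseteq> {x. exp x = poly p x}" by (auto simp: Z_def)
  then have fin: "finite Z" using finite_exp_eq_poly finite_subset by blast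
  have "M < card Z"
    unfolding Z_def
  proof (rule orthogonal_imp_many_zeros)
    show "continuous_on {-1..1} (\<lambda>x. exp x - poly p x)" by (intro continuous_intros)
    show "finite {x\<in>{-1..1}. exp x - poly p x = 0}" using fin by (simp add: Z_def)
  qed (simp add: p_def chebyshev_remainder_orthogonal[OF cont])
  then obtain S where S: "S \<subseteq> Z" "card S = Suc M"
    by (meson Suc_leI obtain_subset_with_card_n)
  have "0 < (-1) ^ card S * (exp x - poly p x)"
  proof (rule exp_interpolation_error_sign)
    show "degree p < card S"
      using degree_chebyshev_partial_sum[of exp M] S by (simp add: p_def)
    show "finite S" using S fin finite_subset by blast
    show "exp z = poly p z" "x < z" if "z \<in> S" for z
      using that S assms by (auto simp: Z_def)
  qed
  then show ?thesis by (simp only: S p_def)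
qed

theorem theorem3p2:
  fixes N :: nat and x :: real
  assumes "N \<ge> 1" and "x < -1"
  shows "(\<Sum>n=0..2*N-1. chebyshev_coeff exp n * poly (Chebyshev_T n) x) \<le> exp x
    \<and> exp x \<le> (\<Sum>n=0..2*N. chebyshev_coeff exp n * poly (Chebyshev_T n) x)"
proof -
  have sum: "(\<Sum>n=0..M. chebyshev_coeff exp n * poly (Chebyshev_T n) x)
      = poly (chebyshev_partial_sum exp M) x" for M
    by (simp add: chebyshev_partial_sum_def poly_sum atMost_atLeast0)
  have "Suc (2 * N - 1) = 2 * N" using assms(1) by simp
  then show ?thesis
    using exp_chebyshev_remainder_sign[OF assms(2), of "2 * N - 1"]
      exp_chebyshev_remainder_sign[OF assms(2), of "2 * N"]
    unfolding sum by simp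
qed

end
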